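(* Let $\Omega \subset \mathbb{R}^n$ be a bounded domain, $g:\Omega\to(0,1]$ a measurable edge indicator function, $\lambda\in\mathbb{R}$, $\tau>0$, and let $u^0 \in B$. Let $(u^k)_{k\ge 0}$ be the sequence generated from $u^0$ by the iterative convolution-thresholding scheme: for $k=0,1,2,\dots$, $$\varphi^k = \sqrt{g}\; G_\tau * \big(\sqrt{g}\,(1-2u^k)\big) + \lambda g, \qquad u^{k+1}(\mathbf{x}) = \begin{cases} 1 & \text{if } \varphi^k(\mathbf{x})\le 0,\\ 0 & \text{otherwise,}\end{cases}\qquad \mathbf{x}\in\Omega.$$ Then for every $k=0,1,2,\dots$, $$E^\tau(u^{k+1}) \le E^\tau(u^k).$$ (This holds for any $\tau>0$.)
   Context: Setting: $\Omega\subset\mathbb{R}^n$ is a bounded (image) domain and $g:\Omega\to(0,1]$ is a measurable edge indicator function (typically $g = \frac{1}{1+|\nabla G_\sigma * I|^2}$ for an image $I$ and a Gaussian kernel $G_\sigma$ of standard deviation $\sigma$). For $\tau>0$, the heat kernel on $\mathbb{R}^n$ is $$G_\tau(\mathbf{x}) = \frac{1}{(4\pi\tau)^{n/2}}\exp\Big(-\frac{|\mathbf{x}|^2}{4\tau}\Big),$$ and $*$ denotes convolution on $\mathbb{R}^n$; functions on $\Omega$ such as $\sqrt{g}\,u$ or $\sqrt{g}\,(1-u)$ are extended by zero outside $\Omega$ before convolving. For $\lambda\in\mathbb{R}$ (of any sign) and measurable $u:\Omega\to[0,1]$, the energy is $$E^\tau(u) = \sqrt{\frac{\pi}{\tau}}\int_\Omega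 \Big[\sqrt{g}\,u\; G_\tau*\big(\sqrt{g}\,(1-u)\big) + \lambda\, g\, u\Big]\, d\mathbf{x}.$$ $B = \{u\in BV(\Omega,\mathbb{R}) : u(\mathbf{x})\in\{0,1\}\ \text{for a.e. } \mathbf{x}\in\Omega\}$, where $BV(\Omega,\mathbb{R})$ is the space of functions of bounded variation on $\Omega$. *)

theory Defs
  imports "HOL-Analysis.Analysis"
begin

text \<open>
  Functions on \<open>\<Omega>\<close> are total functions on the ambient space whose values outside \<open>\<Omega>\<close> are never
  used. Measurability and integrals refer to Lebesgue measure.
\<close>

definition heat_kernel :: "real \<Rightarrow> real ^ 'n \<Rightarrow> real" where
  "heat_kernel \<tau> x =
     1 / (4 * pi * \<tau>) powr (real CARD('n) / 2) * exp (- (norm x)\<^sup>2 / (4 * \<tau>))"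

definition convolve :: "(real ^ 'n \<Rightarrow> real) \<Rightarrow> (real ^ 'n \<Rightarrow> real) \<Rightarrow> real ^ 'n \<Rightarrow> real" where
  "convolve f h x = (LINT y|lebesgue. f (x - y) * h y)"

definition zero_ext :: "(real ^ 'n) set \<Rightarrow> (real ^ 'n \<Rightarrow> real) \<Rightarrow> real ^ 'n \<Rightarrow> real" where
  "zero_ext \<Omega> f x = (if x \<in> \<Omega> then f x else 0)"

definition energy ::
  "(real ^ 'n) set \<Rightarrow> (real ^ 'n \<Rightarrow> real) \<Rightarrow> real \<Rightarrow> real \<Rightarrow> (real ^ 'n \<Rightarrow> real) \<Rightarrow> real" where
  "energy \<Omega> g lam \<tau> u =
     sqrt (pi / \<tau>) *
       (LINT x|lebesgue_on \<Omega>.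
          sqrt (g x) * u x *
            convolve (heat_kernel \<tau>) (zero_ext \<Omega> (\<lambda>y. sqrt (g y) * (1 - u y))) x
          + lam * g x * u x)"

definition threshold_field ::
  "(real ^ 'n) set \<Rightarrow> (real ^ 'n \<Rightarrow> real) \<Rightarrow> real \<Rightarrow> real \<Rightarrow> (real ^ 'n \<Rightarrow> real) \<Rightarrow> real ^ 'n \<Rightarrow> real" where
  "threshold_field \<Omega> g lam \<tau> u x =
     sqrt (g x) * convolve (heat_kernel \<tau>) (zero_ext \<Omega> (\<lambda>y. sqrt (g y) * (1 - 2 * u y))) x
     + lam * g x"

definition divergence :: "(real ^ 'n \<Rightarrow> real ^ 'n) \<Rightarrow> real ^ 'n \<Rightarrow> real" where
  "divergence \<phi> x = (\<Sum>i\<in>UNIV. frechet_derivative \<phi> (at x) (axis i 1) $ i)"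

text \<open>
  The vector fields in \<open>C\<^sub>c\<^sup>1(\<Omega>; \<real>\<^sup>n)\<close> with \<open>\<bar>\<phi>\<bar> \<le> 1\<close>. A field is represented by its extension by zero,
  which is \<open>C\<^sup>1\<close> on the whole space because its support is a compact subset of \<open>\<Omega>\<close>.
\<close>

definition test_fields :: "(real ^ 'n) set \<Rightarrow> (real ^ 'n \<Rightarrow> real ^ 'n) set" where
  "test_fields \<Omega> = {\<phi>.
     (\<forall>x. \<phi> differentiable (at x)) \<and>
     (\<forall>i. continuous_on UNIV (\<lambda>x. frechet_derivative \<phi> (at x) (axis i 1))) \<and>
     compact (closure {x. \<phi> x \<noteq> 0}) \<and> closure {x. \<phi> x \<noteq> 0} \<subseteq> \<Omega> \<and>
     (\<forall>x. norm (\<phi> x) \<le> 1)}"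

definition total_variation :: "(real ^ 'n) set \<Rightarrow> (real ^ 'n \<Rightarrow> real) \<Rightarrow> ereal" where
  "total_variation \<Omega> u =
     (SUP \<phi>\<in>test_fields \<Omega>. ereal (LINT x|lebesgue_on \<Omega>. u x * divergence \<phi> x))"

definition BV :: "(real ^ 'n) set \<Rightarrow> (real ^ 'n \<Rightarrow> real) set" where
  "BV \<Omega> = {u. integrable (lebesgue_on \<Omega>) u \<and> total_variation \<Omega> u < \<infinity>}"

definition binary_BV :: "(real ^ 'n) set \<Rightarrow> (real ^ 'n \<Rightarrow> real) set" where
  "binary_BV \<Omega> = {u \<in> BV \<Omega>. AE x in lebesgue_on \<Omega>. u x \<in> {0, 1}}"

end

theory Submission
  imports Defs "HOL-Probability.Distributions"
begin

text \<open>
  Write \<open>\<langle>f, h\<rangle>\<close> for the integral of \<open>f (G\<^sub>\<tau> * h)\<close>. This form is bilinear and symmetric, so with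
  \<open>w = \<surd>g (u\<^sup>k\<^sup>+\<^sup>1 - u\<^sup>k)\<close> the energy difference is, up to the positive factor \<open>\<surd>(\<pi>/\<tau>)\<close>, the integral
  of \<open>\<phi>\<^sup>k (u\<^sup>k\<^sup>+\<^sup>1 - u\<^sup>k)\<close> minus \<open>\<langle>w, w\<rangle>\<close>. Thresholding makes the first integrand nonpositive almost
  everywhere, and \<open>\<langle>w, w\<rangle>\<close> is nonnegative because by the semigroup property of the heat kernel it is
  the integral of \<open>(G\<^bsub>\<tau>/2\<^esub> * w)\<^sup>2\<close>.
\<close>

section \<open>The heat kernel\<close>

lemma heat_kernel_nonneg: "0 \<le> heat_kernel t x"
  by (simp add: heat_kernel_def)

lemma heat_kernel_minus_commute: "heat_kernel t (x - y) = heat_kernel t (y - x)"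
  by (simp add: heat_kernel_def norm_minus_commute)

lemma borel_measurable_heat_kernel [measurable]: "heat_kernel t \<in> borel_measurable borel"
  unfolding heat_kernel_def [abs_def] by measurable

lemma heat_kernel_le:
  fixes x :: "real ^ 'n"
  assumes "t > 0"
  shows "heat_kernel t x \<le> 1 / (4 * pi * t) powr (real CARD('n) / 2)"
  using assms by (simp add: heat_kernel_def divide_right_mono)

text \<open>Per coordinate, \<open>exp (- r\<^sup>2 / (4 * t))\<close> is a Gaussian of variance
  \<open>2 * t\<close>, hence the standard deviation \<open>sqrt (2 * t)\<close>. The factorization
  reduces the total mass of the kernel to the one-dimensional normal density.\<close>

lemma heat_kernel_eq_prod:
  fixes x y :: "real ^ 'n"
  assumes "t > 0"
  shows "heat_kernel t (y - x) = (\<Prod>b\<in>Basis. normal_density (x \<bullet> b) (sqrt (2 * t)) (y \<bullet> b))"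
proof -
  have "(\<Prod>b\<in>Basis. normal_density (x \<bullet> b) (sqrt (2 * t)) (y \<bullet> b))
      = (1 / sqrt (4 * pi * t)) ^ CARD('n) * exp (\<Sum>b\<in>Basis. - ((y - x) \<bullet> b)\<^sup>2 / (4 * t))"
    using assms
    by (simp add: normal_density_def prod.distrib prod_dividef exp_sum inner_diff_left field_simps)
  also have "(\<Sum>b\<in>Basis. - ((y - x) \<bullet> b)\<^sup>2 / (4 * t)) = - (norm (y - x))\<^sup>2 / (4 * t)"
  proof -
    have "(norm (y - x))\<^sup>2 = (\<Sum>b\<in>Basis. ((y - x) \<bullet> b)\<^sup>2)"
      unfolding power2_norm_eq_inner by (subst euclidean_inner) (simp add: power2_eq_square)
    then show ?thesis
      by (simp add: sum_divide_distrib sum_negf)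
  qed
  also have "(1 / sqrt (4 * pi * t)) ^ CARD('n) = 1 / (4 * pi * t) powr (real CARD('n) / 2)"
  proof -
    have "sqrt (4 * pi * t) ^ CARD('n) = ((4 * pi * t) powr (1 / 2)) powr real CARD('n)"
      using assms by (simp add: powr_half_sqrt powr_realpow)
    then show ?thesis
      by (simp add: powr_powr power_divide)
  qed
  finally show ?thesis
    by (simp add: heat_kernel_def)
qed

lemma nn_integral_heat_kernel:
  fixes x :: "real ^ 'n"
  assumes "t > 0"
  shows "(\<integral>\<^sup>+ y. heat_kernel t (y - x) \<partial>lebesgue) = 1"
proof -
  have "(\<integral>\<^sup>+ y. heat_kernel t (y - x) \<partial>lebesgue) =
      (\<integral>\<^sup>+ y. (\<Prod>b\<in>Basis. ennreal (normal_density (x \<bullet> b) (sqrt (2 * t)) (y \<bullet> b))) \<partial>lborel)"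
    using assms by (simp add: nn_integral_completion heat_kernel_eq_prod prod_ennreal)
  also have "\<dots> = (\<Prod>b\<in>Basis. \<integral>\<^sup>+ y. normal_density (x \<bullet> b) (sqrt (2 * t)) y \<partial>lborel)"
    by (rule nn_integral_lborel_prod) auto
  also have "\<dots> = 1"
    using assms by (simp add: nn_integral_eq_integral)
  finally show ?thesis .
qed

lemma has_bochner_integral_heat_kernel:
  fixes x :: "real ^ 'n"
  assumes "t > 0"
  shows "has_bochner_integral lebesgue (\<lambda>y. heat_kernel t (y - x)) 1"
proof (rule has_bochner_integral_nn_integral)
  show "(\<lambda>y. heat_kernel t (y - x)) \<in> borel_measurable lebesgue"
    by (rule measurable_completion) measurable
qed (use assms in \<open>auto simp: heat_kernel_nonneg nn_integral_heat_kernel\<close>)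

text \<open>Completing the square in \<open>z\<close>.\<close>

lemma heat_kernel_mult:
  fixes x y z :: "real ^ 'n"
  assumes "t > 0"
  shows "heat_kernel (t / 2) (z - x) * heat_kernel (t / 2) (z - y)
      = heat_kernel t (x - y) * heat_kernel (t / 4) (z - (1 / 2) *\<^sub>R (x + y))"
proof -
  have e: "(norm (z - x))\<^sup>2 / (2 * t) + (norm (z - y))\<^sup>2 / (2 * t)
      = (norm (x - y))\<^sup>2 / (4 * t) + (norm (z - (1 / 2) *\<^sub>R (x + y)))\<^sup>2 / t"
    using assms
    by (simp add: power2_norm_eq_inner inner_diff_left inner_diff_right inner_add_left
        inner_add_right inner_commute field_simps)
  \<comment> \<open>The normalizing constants at times \<open>t / 2\<close>, \<open>t / 2\<close>
    and \<open>t\<close>, \<open>t / 4\<close> agree because (2 pi t)^2 = (4 pi t)(pi t).\<close>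
  have c: "(2 * pi * t) powr a * (2 * pi * t) powr a = (4 * pi * t) powr a * (pi * t) powr a" for a
    using assms by (simp add: ac_simps flip: powr_mult)
  have "heat_kernel (t / 2) (z - x) * heat_kernel (t / 2) (z - y)
      = 1 / ((2 * pi * t) powr (real CARD('n) / 2) * (2 * pi * t) powr (real CARD('n) / 2))
        * exp (- ((norm (z - x))\<^sup>2 / (2 * t) + (norm (z - y))\<^sup>2 / (2 * t)))"
    by (simp add: heat_kernel_def exp_add exp_minus exp_diff field_simps)
  also have "\<dots> = heat_kernel t (x - y) * heat_kernel (t / 4) (z - (1 / 2) *\<^sub>R (x + y))"
    unfolding e c by (simp add: heat_kernel_def exp_add exp_minus exp_diff field_simps)
  finally show ?thesis .
qed

text \<open>After the square is completed, \<open>z\<close> occurs only in a kernel at time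
  \<open>t / 4\<close> centred at the midpoint of \<open>x\<close> and \<open>y\<close>, and this
  kernel has total mass 1.\<close>

lemma heat_kernel_semigroup:
  fixes x y :: "real ^ 'n"
  assumes "t > 0"
  shows "heat_kernel t (x - y) =
    (LINT z|lebesgue. heat_kernel (t / 2) (z - x) * heat_kernel (t / 2) (z - y))"
  using has_bochner_integral_integral_eq
    [OF has_bochner_integral_heat_kernel [of "t / 4" "(1 / 2) *\<^sub>R (x + y)"]] assms
  by (simp add: heat_kernel_mult)


section \<open>The bilinear form of the heat kernel\<close>

text \<open>Makes Fubini available for the product of two completed measures, as the functions in
  play are only Lebesgue measurable. A countable cover for \<open>lborel\<close> serves again, since
  the completion keeps the measure of its sets.\<close>

lemma sigma_finite_lebesgue: "sigma_finite_measure (lebesgue :: 'a::euclidean_space measure)"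
proof
  obtain A :: "'a set set" where "countable A" "A \<subseteq> sets lborel" "\<Union> A = space lborel"
      "\<forall>a\<in>A. emeasure lborel a \<noteq> \<infinity>"
    using lborel.sigma_finite_countable by blast
  then show "\<exists>A :: 'a set set. countable A \<and> A \<subseteq> sets lebesgue \<and> \<Union> A = space lebesgue \<and>
      (\<forall>a\<in>A. emeasure lebesgue a \<noteq> \<infinity>)"
    by (intro exI [of _ A]) auto
qed

interpretation lebesgue: sigma_finite_measure "lebesgue :: 'a::euclidean_space measure"
  by (rule sigma_finite_lebesgue)

interpretation lebesgue_pair: pair_sigma_finite
    "lebesgue :: 'a::euclidean_space measure" "lebesgue :: 'b::euclidean_space measure"
  by (rule pair_sigma_finite.intro sigma_finite_lebesgue)+

lemma integrable_mult_bounded: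
  fixes f h :: "'a \<Rightarrow> real"
  assumes "f \<in> borel_measurable M" and "AE x in M. \<bar>f x\<bar> \<le> C" and "integrable M h"
  shows "integrable M (\<lambda>x. f x * h x)"
proof (rule Bochner_Integration.integrable_bound)
  show "integrable M (\<lambda>x. C * \<bar>h x\<bar>)"
    using assms(3) by simp
  show "AE x in M. norm (f x * h x) \<le> norm (C * \<bar>h x\<bar>)"
    using assms(2) by eventually_elim (auto simp: abs_mult intro!: mult_right_mono)
qed (use assms in measurable)

lemma borel_measurable_heat_kernel_diff:
  "(\<lambda>y. heat_kernel t (x - y)) \<in> borel_measurable lebesgue"
  by (rule measurable_completion) measurable

text \<open>Both projections are measurable into \<open>borel\<close>, because completion only
  enlarges the sigma-algebra of the source. The kernel is then a Borel function of their
  difference.\<close>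

lemma borel_measurable_heat_kernel_pair:
  "(\<lambda>(x, y). heat_kernel t (x - y)) \<in> borel_measurable (lebesgue \<Otimes>\<^sub>M lebesgue)"
proof -
  have "(\<lambda>p. fst p) \<in> lebesgue \<Otimes>\<^sub>M lebesgue \<rightarrow>\<^sub>M (borel :: (real ^ 'n) measure)"
    by (rule measurable_compose [OF measurable_fst]) (simp add: measurable_completion)
  moreover have "(\<lambda>p. snd p) \<in> lebesgue \<Otimes>\<^sub>M lebesgue \<rightarrow>\<^sub>M (borel :: (real ^ 'n) measure)"
    by (rule measurable_compose [OF measurable_snd]) (simp add: measurable_completion)
  ultimately have [measurable]: "(\<lambda>p. fst p - snd p)
      \<in> lebesgue \<Otimes>\<^sub>M lebesgue \<rightarrow>\<^sub>M (borel :: (real ^ 'n) measure)"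
    by (rule borel_measurable_diff)
  show ?thesis
    unfolding split_beta' by measurable
qed

text \<open>The integral runs over the whole space, so that symmetry and positivity can be proved
  without a domain. The set \<Omega> enters later through zero-extended arguments.\<close>

definition heat_form :: "real \<Rightarrow> (real ^ 'n \<Rightarrow> real) \<Rightarrow> (real ^ 'n \<Rightarrow> real) \<Rightarrow> real" where
  "heat_form t f h = (LINT x|lebesgue. f x * convolve (heat_kernel t) h x)"

section \<open>Boundedness, linearity and symmetry of the form\<close>

context
  fixes t :: real
  assumes t: "t > 0"
begin

lemma heat_kernel_bounded: obtains C where "\<And>x :: real ^ 'n. \<bar>heat_kernel t x\<bar> \<le> C"
proof
  show "\<bar>heat_kernel t x\<bar> \<le> 1 / (4 * pi * t) powr (real CARD('n) / 2)" for x :: "real ^ 'n"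
    using heat_kernel_le [OF t, of x] by (simp add: heat_kernel_nonneg)
qed

lemma integrable_heat_kernel_mult:
  fixes h :: "real ^ 'n \<Rightarrow> real"
  assumes "integrable lebesgue h"
  shows "integrable lebesgue (\<lambda>y. heat_kernel t (x - y) * h y)"
proof -
  obtain C where "\<And>x :: real ^ 'n. \<bar>heat_kernel t x\<bar> \<le> C"
    using heat_kernel_bounded by blast
  then show ?thesis
    using assms by (intro integrable_mult_bounded [where C = C] borel_measurable_heat_kernel_diff) auto
qed

lemma borel_measurable_convolve:
  assumes "integrable lebesgue h"
  shows "convolve (heat_kernel t) h \<in> borel_measurable lebesgue"
proof -
  have "(\<lambda>(x, y). heat_kernel t (x - y) * h y) \<in> borel_measurable (lebesgue \<Otimes>\<^sub>M lebesgue)"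
    using borel_measurable_heat_kernel_pair assms unfolding split_beta' by measurable
  then show ?thesis
    unfolding convolve_def [abs_def] by (rule lebesgue.borel_measurable_lebesgue_integral)
qed

text \<open>The kernel is bounded, so the convolution is at most its bound times the L^1 norm of
  \<open>h\<close>. Integrability of both arguments therefore suffices for the form to be well
  defined.\<close>

lemma convolve_bounded:
  fixes h :: "real ^ 'n \<Rightarrow> real"
  assumes "integrable lebesgue h"
  obtains C where "\<And>x. \<bar>convolve (heat_kernel t) h x\<bar> \<le> C"
proof -
  obtain C where C: "\<And>x :: real ^ 'n. \<bar>heat_kernel t x\<bar> \<le> C"
    using heat_kernel_bounded by blast
  have "\<bar>convolve (heat_kernel t) h x\<bar> \<le> (LINT y|lebesgue. C * \<bar>h y\<bar>)" for x
  proof -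
    have "\<bar>convolve (heat_kernel t) h x\<bar> \<le> (LINT y|lebesgue. \<bar>heat_kernel t (x - y) * h y\<bar>)"
      unfolding convolve_def by (rule integral_abs_bound)
    also have "\<dots> \<le> (LINT y|lebesgue. C * \<bar>h y\<bar>)"
      using assms C
      by (intro integral_mono integrable_abs integrable_heat_kernel_mult)
         (auto simp: abs_mult intro!: mult_right_mono)
    finally show ?thesis .
  qed
  then show thesis
    by (rule that)
qed

lemma integrable_mult_convolve:
  assumes "integrable lebesgue f" "integrable lebesgue h"
  shows "integrable lebesgue (\<lambda>x. f x * convolve (heat_kernel t) h x)"
proof -
  obtain C where "\<And>x. \<bar>convolve (heat_kernel t) h x\<bar> \<le> C"
    using convolve_bounded [OF assms(2)] by blast
  then have "integrable lebesgue (\<lambda>x. convolve (heat_kernel t) h x * f x)"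
    using assms by (intro integrable_mult_bounded [where C = C] borel_measurable_convolve) auto
  then show ?thesis
    by (simp add: mult.commute)
qed

lemma convolve_diff:
  assumes "integrable lebesgue f" "integrable lebesgue h"
  shows "convolve (heat_kernel t) (\<lambda>y. f y - h y) x
    = convolve (heat_kernel t) f x - convolve (heat_kernel t) h x"
  unfolding convolve_def using assms by (simp add: right_diff_distrib integrable_heat_kernel_mult)

lemma heat_form_diff_left:
  assumes "integrable lebesgue f" "integrable lebesgue f'" "integrable lebesgue h"
  shows "heat_form t (\<lambda>x. f x - f' x) h = heat_form t f h - heat_form t f' h"
  unfolding heat_form_def using assms by (simp add: left_diff_distrib integrable_mult_convolve)

lemma heat_form_diff_right:
  assumes "integrable lebesgue f" "integrable lebesgue h" "integrable lebesgue h'"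
  shows "heat_form t f (\<lambda>x. h x - h' x) = heat_form t f h - heat_form t f h'"
  unfolding heat_form_def using assms
  by (simp add: convolve_diff right_diff_distrib integrable_mult_convolve)

text \<open>Integrating the absolute value over \<open>z\<close> first leaves
  \<open>\<bar>f x\<bar>\<close>, since the kernel has mass 1. This is the integrable function
  behind the exchanges of integrals in the positivity proof.\<close>

lemma integrable_pair_heat_kernel:
  fixes f :: "real ^ 'n \<Rightarrow> real"
  assumes f: "integrable lebesgue f"
  shows "integrable (lebesgue \<Otimes>\<^sub>M lebesgue) (\<lambda>(x, z). f x * heat_kernel t (z - x))"
proof (rule lebesgue_pair.Fubini_integrable)
  show "(\<lambda>(x, z). f x * heat_kernel t (z - x)) \<in> borel_measurable (lebesgue \<Otimes>\<^sub>M lebesgue)"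
    using borel_measurable_heat_kernel_pair f
    unfolding split_beta' heat_kernel_minus_commute [of t "snd _"] by measurable
  have K: "integrable lebesgue (\<lambda>z. heat_kernel t (z - x))"
      "(LINT z|lebesgue. heat_kernel t (z - x)) = 1" for x :: "real ^ 'n"
    using has_bochner_integral_heat_kernel [OF t, of x]
    by (auto simp: has_bochner_integral_iff)
  show "integrable lebesgue (\<lambda>x. LINT z|lebesgue. norm (case (x, z) of (x, z) \<Rightarrow> f x * heat_kernel t (z - x)))"
    using f by (simp add: abs_mult heat_kernel_nonneg K)
  show "AE x in lebesgue. integrable lebesgue (\<lambda>z. case (x, z) of (x, z) \<Rightarrow> f x * heat_kernel t (z - x))"
    by (simp add: K)
qed

text \<open>Fubini together with the evenness of the kernel.\<close>

lemma heat_form_commute: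
  assumes f: "integrable lebesgue f" and h: "integrable lebesgue h"
  shows "heat_form t f h = heat_form t h f"
proof -
  have "integrable (lebesgue \<Otimes>\<^sub>M lebesgue) (\<lambda>(x, y). f x * (heat_kernel t (x - y) * h y))"
  proof (rule lebesgue_pair.Fubini_integrable)
    show "(\<lambda>(x, y). f x * (heat_kernel t (x - y) * h y)) \<in> borel_measurable (lebesgue \<Otimes>\<^sub>M lebesgue)"
      using borel_measurable_heat_kernel_pair f h unfolding split_beta' by measurable
    \<comment> \<open>As the kernel is nonnegative, the inner integral of the absolute value is
      again a convolution, now with \<open>\<bar>h\<bar>\<close>.\<close>
    have "integrable lebesgue (\<lambda>x. \<bar>f x\<bar> * convolve (heat_kernel t) (\<lambda>y. \<bar>h y\<bar>) x)"
      using f h by (intro integrable_mult_convolve) auto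
    then show "integrable lebesgue
        (\<lambda>x. LINT y|lebesgue. norm (case (x, y) of (x, y) \<Rightarrow> f x * (heat_kernel t (x - y) * h y)))"
      by (simp add: abs_mult heat_kernel_nonneg convolve_def)
    show "AE x in lebesgue. integrable lebesgue
        (\<lambda>y. case (x, y) of (x, y) \<Rightarrow> f x * (heat_kernel t (x - y) * h y))"
      using h by (simp add: integrable_heat_kernel_mult)
  qed
  then have "(LINT y|lebesgue. LINT x|lebesgue. f x * (heat_kernel t (x - y) * h y))
      = (LINT x|lebesgue. LINT y|lebesgue. f x * (heat_kernel t (x - y) * h y))"
    by (rule lebesgue_pair.Fubini_integral)
  also have "\<dots> = heat_form t f h"
    by (simp add: heat_form_def convolve_def)
  also have "(LINT y|lebesgue. LINT x|lebesgue. f x * (heat_kernel t (x - y) * h y)) = heat_form t h f"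
  proof -
    have "(LINT x|lebesgue. f x * (heat_kernel t (x - y) * h y)) = h y * convolve (heat_kernel t) f y" for y
      unfolding convolve_def heat_kernel_minus_commute [of t y]
      by (simp add: ac_simps flip: integral_mult_right_zero)
    then show ?thesis
      by (simp add: heat_form_def)
  qed
  finally show ?thesis ..
qed

end

section \<open>Positivity of the form\<close>

lemma heat_form_nonneg:
  fixes w :: "real ^ 'n \<Rightarrow> real"
  assumes "t > 0" and w: "integrable lebesgue w"
  shows "0 \<le> heat_form t w w"
proof -
  define s where "s = t / 2"
  have s: "s > 0"
    using assms by (simp add: s_def)
  define W where "W = convolve (heat_kernel s) w"
  have W_eq: "W z = (LINT y|lebesgue. w y * heat_kernel s (z - y))" for z
    by (simp add: W_def convolve_def mult.commute)
  \<comment> \<open>One exchange of integrals for an arbitrary bounded factor \<open>F\<close>, used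
    twice. With \<open>F\<close> a kernel centred at a fixed point it turns the semigroup identity
    into G_t * w = G_s * W, and with \<open>F = W\<close> it moves the remaining kernel onto
    \<open>w\<close>, giving the integral of \<open>W z * W z\<close>.\<close>
  have swap: "(LINT x|lebesgue. LINT z|lebesgue. F z * (w x * heat_kernel s (z - x)))
      = (LINT z|lebesgue. F z * W z)"
    if F: "F \<in> borel_measurable lebesgue" "\<And>z. \<bar>F z\<bar> \<le> C" for F C
  proof -
    have "integrable (lebesgue \<Otimes>\<^sub>M lebesgue)
        (\<lambda>p. F (snd p) * (case p of (x, z) \<Rightarrow> w x * heat_kernel s (z - x)))"
      using F(2)
      by (intro integrable_mult_bounded [where C = C] integrable_pair_heat_kernel s w
          measurable_compose [OF measurable_snd F(1)]) auto
    then have "integrable (lebesgue \<Otimes>\<^sub>M lebesgue) (\<lambda>(x, z). F z * (w x * heat_kernel s (z - x)))"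
      by (simp add: split_beta')
    from lebesgue_pair.Fubini_integral [OF this] show ?thesis
      by (simp add: W_eq)
  qed
  have conv: "convolve (heat_kernel t) w x = (LINT z|lebesgue. heat_kernel s (z - x) * W z)" for x
  proof -
    obtain C where C: "\<And>x :: real ^ 'n. \<bar>heat_kernel s x\<bar> \<le> C"
      using heat_kernel_bounded [OF s] by blast
    have "convolve (heat_kernel t) w x =
        (LINT y|lebesgue. LINT z|lebesgue. heat_kernel s (z - x) * (w y * heat_kernel s (z - y)))"
      unfolding convolve_def heat_kernel_semigroup [OF \<open>t > 0\<close>] s_def
      by (simp add: ac_simps flip: integral_mult_left_zero)
    also have "\<dots> = (LINT z|lebesgue. heat_kernel s (z - x) * W z)"
    proof (rule swap)
      show "(\<lambda>z. heat_kernel s (z - x)) \<in> borel_measurable lebesgue"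
        by (rule measurable_completion) measurable
    qed (rule C)
    finally show ?thesis .
  qed
  obtain C where C: "\<And>x. \<bar>W x\<bar> \<le> C"
    using convolve_bounded [OF s w] unfolding W_def by blast
  have "heat_form t w w =
      (LINT x|lebesgue. LINT z|lebesgue. W z * (w x * heat_kernel s (z - x)))"
    unfolding heat_form_def conv
    by (simp add: ac_simps flip: integral_mult_right_zero)
  also have "\<dots> = (LINT z|lebesgue. W z * W z)"
    using borel_measurable_convolve [OF s w] C by (intro swap) (auto simp: W_def)
  also have "\<dots> \<ge> 0"
    by simp
  finally show ?thesis .
qed


section \<open>The energy\<close>

lemma zero_ext_eq_indicator: "zero_ext \<Omega> f = (\<lambda>x. indicator \<Omega> x *\<^sub>R f x)"
  by (auto simp: zero_ext_def)

lemma integrable_zero_ext: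
  "\<Omega> \<in> sets lebesgue \<Longrightarrow> integrable (lebesgue_on \<Omega>) f \<Longrightarrow> integrable lebesgue (zero_ext \<Omega> f)"
  by (simp add: zero_ext_eq_indicator integrable_restrict_space)

lemma integral_lebesgue_on_eq_zero_ext:
  "\<Omega> \<in> sets lebesgue \<Longrightarrow> (LINT x|lebesgue_on \<Omega>. f x) = (LINT x|lebesgue. zero_ext \<Omega> f x)"
  by (simp add: zero_ext_eq_indicator integral_restrict_space)

text \<open>The energy integral and the integral of \<open>threshold_field\<close> against a
  difference both have this shape, so each splits into a value of the form and a linear term in
  \<open>g\<close>.\<close>

lemma integral_mult_convolve_add:
  fixes f h k :: "real ^ 'n \<Rightarrow> real"
  assumes "t > 0" and \<Omega>: "\<Omega> \<in> sets lebesgue"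
    and f: "integrable (lebesgue_on \<Omega>) f" and h: "integrable lebesgue h"
    and k: "integrable (lebesgue_on \<Omega>) k"
  shows "(LINT x|lebesgue_on \<Omega>. f x * convolve (heat_kernel t) h x + k x)
    = heat_form t (zero_ext \<Omega> f) h + (LINT x|lebesgue_on \<Omega>. k x)"
proof -
  have "(LINT x|lebesgue_on \<Omega>. f x * convolve (heat_kernel t) h x + k x)
      = (LINT x|lebesgue. zero_ext \<Omega> f x * convolve (heat_kernel t) h x + zero_ext \<Omega> k x)"
    unfolding integral_lebesgue_on_eq_zero_ext [OF \<Omega>]
    by (rule Bochner_Integration.integral_cong) (auto simp: zero_ext_def)
  also have "\<dots> = heat_form t (zero_ext \<Omega> f) h + (LINT x|lebesgue. zero_ext \<Omega> k x)"
    unfolding heat_form_def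
    by (intro Bochner_Integration.integral_add integrable_mult_convolve integrable_zero_ext assms)
  finally show ?thesis
    by (simp add: integral_lebesgue_on_eq_zero_ext [OF \<Omega>])
qed

text \<open>The energy is quadratic in its argument, so its expansion at \<open>u\<close> stops at
  second order and is exact. Up to the factor \<open>sqrt (pi / \<tau>)\<close>,
  \<open>threshold_field\<close> is the first variation at \<open>u\<close>, and the second-order
  term is minus the form at \<open>w\<close>.\<close>

lemma energy_diff:
  fixes g u v :: "real ^ 'n \<Rightarrow> real"
  assumes "\<tau> > 0" and \<Omega>: "\<Omega> \<in> sets lebesgue"
    and s: "integrable (lebesgue_on \<Omega>) (\<lambda>x. sqrt (g x))"
    and u: "integrable (lebesgue_on \<Omega>) (\<lambda>x. sqrt (g x) * u x)"
    and v: "integrable (lebesgue_on \<Omega>) (\<lambda>x. sqrt (g x) * v x)"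
    and gu: "integrable (lebesgue_on \<Omega>) (\<lambda>x. g x * u x)"
    and gv: "integrable (lebesgue_on \<Omega>) (\<lambda>x. g x * v x)"
  defines "w \<equiv> zero_ext \<Omega> (\<lambda>x. sqrt (g x) * (v x - u x))"
  shows "energy \<Omega> g lam \<tau> v - energy \<Omega> g lam \<tau> u = sqrt (pi / \<tau>) *
    ((LINT x|lebesgue_on \<Omega>. threshold_field \<Omega> g lam \<tau> u x * (v x - u x)) - heat_form \<tau> w w)"
proof -
  define S a b where "S = zero_ext \<Omega> (\<lambda>x. sqrt (g x))"
    and "a = zero_ext \<Omega> (\<lambda>x. sqrt (g x) * u x)" and "b = zero_ext \<Omega> (\<lambda>x. sqrt (g x) * v x)"
  have int: "integrable lebesgue S" "integrable lebesgue a" "integrable lebesgue b"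
    unfolding S_def a_def b_def by (intro integrable_zero_ext \<Omega> s u v)+
  have w: "w = (\<lambda>x. b x - a x)"
    by (auto simp: w_def a_def b_def zero_ext_def algebra_simps)
  have energy_eq: "energy \<Omega> g lam \<tau> f = sqrt (pi / \<tau>) *
      (heat_form \<tau> F (\<lambda>x. S x - F x) + lam * (LINT x|lebesgue_on \<Omega>. g x * f x))"
    if f: "integrable (lebesgue_on \<Omega>) (\<lambda>x. sqrt (g x) * f x)"
      and gf: "integrable (lebesgue_on \<Omega>) (\<lambda>x. g x * f x)"
      and F: "F = zero_ext \<Omega> (\<lambda>x. sqrt (g x) * f x)" for f F
  proof -
    have "zero_ext \<Omega> (\<lambda>x. sqrt (g x) * (1 - f x)) = (\<lambda>x. S x - F x)"
      by (auto simp: F S_def zero_ext_def algebra_simps)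
    moreover have "integrable lebesgue (\<lambda>x. S x - F x)"
      unfolding F by (intro Bochner_Integration.integrable_diff int integrable_zero_ext \<Omega> f)
    ultimately show ?thesis
      using integral_mult_convolve_add [OF \<open>\<tau> > 0\<close> \<Omega> f, of _ "\<lambda>x. lam * (g x * f x)"] gf
      by (simp add: energy_def F mult.assoc)
  qed
  have "(LINT x|lebesgue_on \<Omega>. threshold_field \<Omega> g lam \<tau> u x * (v x - u x)) =
      heat_form \<tau> w (\<lambda>x. S x - a x - a x) +
      lam * ((LINT x|lebesgue_on \<Omega>. g x * v x) - (LINT x|lebesgue_on \<Omega>. g x * u x))"
  proof -
    \<comment> \<open>Writing 1 - 2u as \<open>S x - a x - a x\<close> keeps everything a
      difference, so the two difference rules for the form are enough to expand it.\<close>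
    have "zero_ext \<Omega> (\<lambda>x. sqrt (g x) * (1 - 2 * u x)) = (\<lambda>x. S x - a x - a x)"
      by (auto simp: a_def S_def zero_ext_def algebra_simps)
    then have "threshold_field \<Omega> g lam \<tau> u x * (v x - u x) =
        sqrt (g x) * (v x - u x) * convolve (heat_kernel \<tau>) (\<lambda>x. S x - a x - a x) x
        + lam * (g x * v x - g x * u x)" for x
      by (simp add: threshold_field_def algebra_simps)
    moreover have "integrable (lebesgue_on \<Omega>) (\<lambda>x. sqrt (g x) * (v x - u x))"
      using Bochner_Integration.integrable_diff [OF v u] by (simp add: right_diff_distrib)
    ultimately show ?thesis
      using int gu gv by (simp add: integral_mult_convolve_add \<open>\<tau> > 0\<close> \<Omega> w_def)
  qed
  \<comment> \<open>Expanding both sides by bilinearity leaves the two mixed terms in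
    \<open>a\<close> and \<open>b\<close>, which symmetry identifies.\<close>
  moreover have "heat_form \<tau> b (\<lambda>x. S x - b x) - heat_form \<tau> a (\<lambda>x. S x - a x) =
      heat_form \<tau> w (\<lambda>x. S x - a x - a x) - heat_form \<tau> w w"
    using int heat_form_commute [OF \<open>\<tau> > 0\<close> int(2) int(3)]
    by (simp only: w heat_form_diff_left heat_form_diff_right Bochner_Integration.integrable_diff
        \<open>\<tau> > 0\<close>)
  ultimately show ?thesis
    unfolding energy_eq [OF u gu a_def] energy_eq [OF v gv b_def]
    by (simp only: right_diff_distrib [symmetric, of "sqrt (pi / \<tau>)"])
       (simp add: right_diff_distrib [of lam])
qed

section \<open>Decrease of the energy along the iteration\<close>

theorem theorem3p4:
  fixes \<Omega> :: "(real ^ 'n) set"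
    and g :: "real ^ 'n \<Rightarrow> real"
    and lam \<tau> :: real
    and u :: "nat \<Rightarrow> real ^ 'n \<Rightarrow> real"
  assumes "open \<Omega>" and "connected \<Omega>" and "\<Omega> \<noteq> {}" and "bounded \<Omega>"
    and "g \<in> borel_measurable (lebesgue_on \<Omega>)"
    and "\<And>x. x \<in> \<Omega> \<Longrightarrow> 0 < g x \<and> g x \<le> 1"
    and "\<tau> > 0"
    and "u 0 \<in> binary_BV \<Omega>"
    and "\<And>k x. x \<in> \<Omega> \<Longrightarrow>
           u (Suc k) x = (if threshold_field \<Omega> g lam \<tau> (u k) x \<le> 0 then 1 else 0)"
  shows "\<forall>k. energy \<Omega> g lam \<tau> (u (Suc k)) \<le> energy \<Omega> g lam \<tau> (u k)"
proof
  note g [measurable] = assms(5)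
  have \<Omega>: "\<Omega> \<in> sets lebesgue"
    using \<open>open \<Omega>\<close> by (simp add: borel_open)
  have one: "integrable (lebesgue_on \<Omega>) (\<lambda>x. 1 :: real)"
    using \<open>bounded \<Omega>\<close> \<Omega>
    by (simp add: integrable_restrict_space bounded_set_imp_lmeasurable flip: lmeasurable_iff_integrable)
  \<comment> \<open>A bounded domain has finite measure, so measurable functions bounded by 1 almost
    everywhere are integrable. This supplies every integrability hypothesis of
    \<open>energy_diff\<close>.\<close>
  have bounded_int: "integrable (lebesgue_on \<Omega>) f"
    if "f \<in> borel_measurable (lebesgue_on \<Omega>)" "AE x in lebesgue_on \<Omega>. \<bar>f x\<bar> \<le> 1" for f :: "real ^ 'n \<Rightarrow> real"
    using integrable_mult_bounded [OF that one] by simp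
  have g_AE: "AE x in lebesgue_on \<Omega>. 0 < g x \<and> g x \<le> 1"
    using assms(6) \<Omega> by (intro AE_I2) simp
  have int: "integrable (lebesgue_on \<Omega>) (\<lambda>x. sqrt (g x) * f x)"
      "integrable (lebesgue_on \<Omega>) (\<lambda>x. g x * f x)"
    if [measurable]: "f \<in> borel_measurable (lebesgue_on \<Omega>)"
      and f: "AE x in lebesgue_on \<Omega>. f x \<in> {0, 1}" for f :: "real ^ 'n \<Rightarrow> real"
  proof -
    show "integrable (lebesgue_on \<Omega>) (\<lambda>x. sqrt (g x) * f x)"
    proof (rule bounded_int)
      show "AE x in lebesgue_on \<Omega>. \<bar>sqrt (g x) * f x\<bar> \<le> 1"
        using g_AE f by eventually_elim auto
    qed measurable
    show "integrable (lebesgue_on \<Omega>) (\<lambda>x. g x * f x)"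
    proof (rule bounded_int)
      show "AE x in lebesgue_on \<Omega>. \<bar>g x * f x\<bar> \<le> 1"
        using g_AE f by eventually_elim auto
    qed measurable
  qed
  have s: "integrable (lebesgue_on \<Omega>) (\<lambda>x. sqrt (g x))"
    using int(1) [of "\<lambda>_. 1"] by simp
  \<comment> \<open>The invariant of the iteration. It holds for \<open>u 0\<close> by membership in
    \<open>binary_BV\<close>. Each later iterate is, on \<Omega>, the indicator of a sublevel set of
    a measurable field.\<close>
  have u: "u k \<in> borel_measurable (lebesgue_on \<Omega>) \<and> (AE x in lebesgue_on \<Omega>. u k x \<in> {0, 1})" for k
  proof (induction k)
    case 0
    then show ?case
      using \<open>u 0 \<in> binary_BV \<Omega>\<close> by (auto simp: binary_BV_def BV_def)
  next
    case (Suc k)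
    have "integrable (lebesgue_on \<Omega>) (\<lambda>x. sqrt (g x) - 2 * (sqrt (g x) * u k x))"
      using s int(1) [of "u k"] Suc by simp
    then have "integrable (lebesgue_on \<Omega>) (\<lambda>x. sqrt (g x) * (1 - 2 * u k x))"
      by (simp add: algebra_simps)
    then have [measurable]: "convolve (heat_kernel \<tau>) (zero_ext \<Omega> (\<lambda>x. sqrt (g x) * (1 - 2 * u k x)))
        \<in> borel_measurable (lebesgue_on \<Omega>)"
      by (intro measurable_restrict_space1 borel_measurable_convolve integrable_zero_ext \<open>\<tau> > 0\<close> \<Omega>)
    have "(\<lambda>x. if threshold_field \<Omega> g lam \<tau> (u k) x \<le> 0 then 1 else 0 :: real)
        \<in> borel_measurable (lebesgue_on \<Omega>)"
      unfolding threshold_field_def by measurable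
    \<comment> \<open>The iterate is prescribed only on \<Omega>, which is the whole space of
      \<open>lebesgue_on \<Omega>\<close>, so measurability transfers by congruence.\<close>
    then have "u (Suc k) \<in> borel_measurable (lebesgue_on \<Omega>)"
      by (rule measurable_cong [THEN iffD1, rotated]) (use \<Omega> in \<open>simp add: assms(9)\<close>)
    moreover have "AE x in lebesgue_on \<Omega>. u (Suc k) x \<in> {0, 1}"
      using \<Omega> by (intro AE_I2) (simp add: assms(9))
    ultimately show ?case ..
  qed
  fix k
  define w where "w = zero_ext \<Omega> (\<lambda>x. sqrt (g x) * (u (Suc k) x - u k x))"
  note uk = u [THEN conjunct1, of k] u [THEN conjunct2, of k]
  note uSuc = u [THEN conjunct1, of "Suc k"] u [THEN conjunct2, of "Suc k"]
  have "integrable (lebesgue_on \<Omega>) (\<lambda>x. sqrt (g x) * (u (Suc k) x - u k x))"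
    unfolding right_diff_distrib
    by (rule Bochner_Integration.integrable_diff [OF int(1) [OF uSuc] int(1) [OF uk]])
  then have "0 \<le> heat_form \<tau> w w"
    unfolding w_def by (rule heat_form_nonneg [OF \<open>\<tau> > 0\<close> integrable_zero_ext [OF \<Omega>]])
  \<comment> \<open>With the sign inside the integral, the claim follows from the sign of the
    integrand alone, and integrability need not be checked.\<close>
  moreover have "0 \<le> (LINT x|lebesgue_on \<Omega>. - (threshold_field \<Omega> g lam \<tau> (u k) x * (u (Suc k) x - u k x)))"
  proof (rule integral_nonneg_AE)
    have "AE x in lebesgue_on \<Omega>. x \<in> \<Omega>"
      using \<Omega> by (intro AE_I2) simp
    \<comment> \<open>Where the field is at most 0, the new value is 1 and the increment is
      nonnegative. Where it is positive, the new value is 0 and the increment is nonpositive. Both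
      use that \<open>u k x\<close> is 0 or 1.\<close>
    then show "AE x in lebesgue_on \<Omega>.
        0 \<le> - (threshold_field \<Omega> g lam \<tau> (u k) x * (u (Suc k) x - u k x))"
      using uk(2) by eventually_elim (auto simp: assms(9))
  qed
  ultimately have "(LINT x|lebesgue_on \<Omega>. threshold_field \<Omega> g lam \<tau> (u k) x * (u (Suc k) x - u k x))
      - heat_form \<tau> w w \<le> 0"
    by (simp only: Bochner_Integration.integral_minus)
  then have "energy \<Omega> g lam \<tau> (u (Suc k)) - energy \<Omega> g lam \<tau> (u k) \<le> 0"
    unfolding w_def
      energy_diff [OF \<open>\<tau> > 0\<close> \<Omega> s int(1) [OF uk] int(1) [OF uSuc] int(2) [OF uk] int(2) [OF uSuc]]
    by (rule mult_nonneg_nonpos [rotated]) (use \<open>\<tau> > 0\<close> in simp)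
  then show "energy \<Omega> g lam \<tau> (u (Suc k)) \<le> energy \<Omega> g lam \<tau> (u k)"
    by simp
qed

end
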